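(* Let $(\lambda_1,\lambda_2,\lambda_3)$ be a composition of $n$ and let $d=\gcd(\lambda_1+\lambda_2,\lambda_2+\lambda_3)$. For every $x\in\llbracket 1,n\rrbracket$, the orbit of $x$ under the symmetric discrete interval exchange $T_{(\lambda_1,\lambda_2,\lambda_3)}$ is the set $$\left\{x+kd \;\middle|\; k\in\mathbb{Z},\ \frac{1-x}{d}\le k\le\frac{n-x}{d}\right\}.$$
   Context: For $\llbracket a,b\rrbracket=[a,b]\cap\mathbb{Z}$ and a composition $(\lambda_1,\lambda_2,\lambda_3)$ of $n$ (positive integers with sum $n$), $T_{(\lambda_1,\lambda_2,\lambda_3)}$ is the permutation of $\llbracket 1,n\rrbracket$ given by $T(x)=x+\lambda_2+\lambda_3$ for $x\in\llbracket 1,\lambda_1\rrbracket$, $T(x)=x+\lambda_3-\lambda_1$ for $x\in\llbracket \lambda_1+1,\lambda_1+\lambda_2\rrbracket$, and $T(x)=x-\lambda_1-\lambda_2$ for $x\in\llbracket \lambda_1+\lambda_2+1,n\rrbracket$. *)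

theory Defs
  imports Complex_Main "HOL-Combinatorics.Orbits"
begin

text \<open>
  The symmetric discrete interval exchange on \<open>{1..l1 + l2 + l3}\<close>, extended by the identity to all
  integers (the library convention for permutations of a subset of a type).
\<close>

definition sdie :: "int \<Rightarrow> int \<Rightarrow> int \<Rightarrow> int \<Rightarrow> int" where
  "sdie l1 l2 l3 x =
    (if x \<in> {1..l1} then x + l2 + l3
     else if x \<in> {l1 + 1..l1 + l2} then x + l3 - l1
     else if x \<in> {l1 + l2 + 1..l1 + l2 + l3} then x - l1 - l2
     else x)"

lemma sdie_permutes:
  assumes "0 < l1" "0 < l2" "0 < l3"
  shows "sdie l1 l2 l3 permutes {1..l1 + l2 + l3}"
proof (rule bij_imp_permutes)
  have inj: "inj_on (sdie l1 l2 l3) {1..l1 + l2 + l3}"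
    using assms by (auto simp: inj_on_def sdie_def split: if_splits)
  have "sdie l1 l2 l3 ` {1..l1 + l2 + l3} \<subseteq> {1..l1 + l2 + l3}"
    using assms by (auto simp: sdie_def)
  then have "sdie l1 l2 l3 ` {1..l1 + l2 + l3} = {1..l1 + l2 + l3}"
    using inj by (intro endo_inj_surj) auto
  with inj show "bij_betw (sdie l1 l2 l3) {1..l1 + l2 + l3} {1..l1 + l2 + l3}"
    by (simp add: bij_betw_def)
next
  fix x assume "x \<notin> {1..l1 + l2 + l3}"
  then show "sdie l1 l2 l3 x = x"
    using assms by (auto simp: sdie_def)
qed

text \<open>
  The library's \<open>orbit f x\<close> collects the iterates with positive exponent only; since the map is a
  permutation with finite support, this is the full orbit.
\<close>

lemma orbit_sdie:
  assumes "0 < l1" "0 < l2" "0 < l3"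
  shows "orbit (sdie l1 l2 l3) x = {(sdie l1 l2 l3 ^^ m) x | m. True}"
proof (rule orbit_altdef_permutation)
  show "permutation (sdie l1 l2 l3)"
    using sdie_permutes[OF assms] by (rule permutes_imp_permutation[rotated]) simp
qed

end

theory Submission
  imports Defs "HOL-Number_Theory.Cong"
begin

text \<open>
  Put \<open>a = l1 + l2\<close> and \<open>b = l2 + l3\<close>. The interval exchange is the first return map to \<open>{1..n}\<close> of
  the rotation \<open>y \<mapsto> y + b\<close> modulo \<open>a + b = n + l2\<close>: on the middle interval the rotation leaves
  \<open>{1..n}\<close> for exactly one step. The orbits of a first return map are the traces of the orbits of
  the original map, and the orbits of the rotation are the residue classes modulo
  \<open>gcd b (a + b) = gcd a b\<close>.
\<close>

definition first_return :: "('a \<Rightarrow> 'a) \<Rightarrow> 'a set \<Rightarrow> 'a \<Rightarrow> 'a" where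
  "first_return f S x = (f ^^ (LEAST m. 0 < m \<and> (f ^^ m) x \<in> S)) x"

lemma first_return_eqI:
  assumes "0 < m" and "(f ^^ m) x \<in> S" and "\<And>i. 0 < i \<Longrightarrow> i < m \<Longrightarrow> (f ^^ i) x \<notin> S"
  shows "first_return f S x = (f ^^ m) x"
proof -
  have "(LEAST i. 0 < i \<and> (f ^^ i) x \<in> S) = m"
    using assms by (intro Least_equality) (auto simp flip: not_less)
  then show ?thesis
    by (simp add: first_return_def)
qed

lemma first_returnE:
  assumes "0 < k" and "(f ^^ k) x \<in> S"
  obtains m where "0 < m" and "m \<le> k" and "first_return f S x = (f ^^ m) x"
    and "first_return f S x \<in> S"
proof -
  define m where "m = (LEAST m. 0 < m \<and> (f ^^ m) x \<in> S)"
  have return: "0 < k \<and> (f ^^ k) x \<in> S"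
    using assms by simp
  then have "0 < m \<and> (f ^^ m) x \<in> S"
    unfolding m_def by (rule LeastI)
  moreover have "m \<le> k"
    unfolding m_def using return by (rule Least_le)
  moreover have "first_return f S x = (f ^^ m) x"
    by (simp only: first_return_def m_def)
  ultimately show thesis
    using that by metis
qed

lemma first_return_in_orbit:
  assumes "orbit f x \<inter> S \<noteq> {}"
  shows "first_return f S x \<in> orbit f x \<inter> S"
proof -
  obtain k where "0 < k" and "(f ^^ k) x \<in> S"
    using assms by (auto simp: orbit_altdef)
  then obtain m where "0 < m" and "first_return f S x = (f ^^ m) x" and "first_return f S x \<in> S"
    by (rule first_returnE)
  then show ?thesis
    by (auto simp: orbit_altdef)
qed

lemma funpow_in_orbit_first_return:
  assumes "0 < k" and "(f ^^ k) x \<in> S"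
  shows "(f ^^ k) x \<in> orbit (first_return f S) x"
  using assms
proof (induction k arbitrary: x rule: less_induct)
  case (less k)
  let ?T = "first_return f S"
  obtain m where "0 < m" and "m \<le> k" and return: "?T x = (f ^^ m) x"
    using less.prems by (rule first_returnE)
  show ?case
  proof (cases "m = k")
    case True
    then show ?thesis
      using return orbit.base by metis
  next
    case False
    have remaining: "(f ^^ k) x = (f ^^ (k - m)) (?T x)"
      using \<open>m \<le> k\<close> return funpow_add[of "k - m" m f] by simp
    have "(f ^^ (k - m)) (?T x) \<in> orbit ?T (?T x)"
      using False \<open>0 < m\<close> \<open>m \<le> k\<close> less.prems(2) remaining by (intro less.IH) simp_all
    then show ?thesis
      unfolding remaining by (rule orbit_subset)
  qed
qed

lemma orbit_first_return:
  assumes "x \<in> S" and recurrent: "\<And>y. y \<in> S \<Longrightarrow> orbit f y \<inter> S \<noteq> {}"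
  shows "orbit (first_return f S) x = orbit f x \<inter> S"
proof (intro equalityI subsetI)
  fix y assume "y \<in> orbit (first_return f S) x"
  then show "y \<in> orbit f x \<inter> S"
  proof induction
    case base
    show ?case
      using assms by (intro first_return_in_orbit)
  next
    case (step y)
    then have "first_return f S y \<in> orbit f y \<inter> S"
      using recurrent by (intro first_return_in_orbit) blast
    with step.IH show ?case
      by (blast intro: orbit_trans)
  qed
next
  fix y assume "y \<in> orbit f x \<inter> S"
  then show "y \<in> orbit (first_return f S) x"
    by (auto simp: orbit_altdef[of f] intro: funpow_in_orbit_first_return)
qed

definition rotation :: "int \<Rightarrow> int \<Rightarrow> int \<Rightarrow> int" where
  "rotation N b y = (y + b) mod N"

lemma funpow_rotation:
  assumes "0 < k"
  shows "(rotation N b ^^ k) x = (x + int k * b) mod N"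
  using assms
proof (induction k rule: nat_induct_non_zero)
  case 1
  show ?case
    by (simp add: rotation_def)
next
  case (Suc k)
  then show ?case
    by (simp add: rotation_def mod_simps algebra_simps)
qed

lemma funpow_rotation_eqI:
  assumes "0 < k" and "y \<in> {0..<N}" and "[y = x + int k * b] (mod N)"
  shows "(rotation N b ^^ k) x = y"
  using assms by (simp add: funpow_rotation cong_def)

lemma cong_solve_pos_nat:
  fixes b c N :: int
  assumes "gcd b N dvd c" and "0 < N"
  obtains k :: nat where "0 < k" and "[int k * b = c] (mod N)"
proof -
  obtain j where solution: "[b * j = c] (mod N)"
    using assms(1) cong_solve_dvd_int by blast
  have "0 < j mod N + N"
    using assms(2) pos_mod_sign[of N j] by linarith
  then obtain k where "0 < k" and "int k = j mod N + N"
    using zero_less_imp_eq_int by metis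
  then have "[int k = j] (mod N)"
    by (simp add: cong_def)
  then have "[int k * b = j * b] (mod N)"
    by (rule cong_scalar_right)
  also have "[j * b = c] (mod N)"
    using solution by (simp add: mult.commute)
  finally show thesis
    using that \<open>0 < k\<close> by blast
qed

lemma orbit_rotation:
  assumes "0 < N"
  shows "orbit (rotation N b) x = {y \<in> {0..<N}. [y = x] (mod gcd b N)}"
proof (intro equalityI subsetI)
  fix y assume "y \<in> orbit (rotation N b) x"
  then obtain k where y_eq: "y = (x + int k * b) mod N"
    by (auto simp: orbit_altdef funpow_rotation)
  have "[y = x + int k * b] (mod gcd b N)"
    unfolding y_eq by (rule cong_dvd_modulus[of _ _ N]) simp_all
  also have "[x + int k * b = x] (mod gcd b N)"
    by (simp add: cong_iff_dvd_diff)
  finally show "y \<in> {y \<in> {0..<N}. [y = x] (mod gcd b N)}"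
    using assms y_eq by simp
next
  fix y assume "y \<in> {y \<in> {0..<N}. [y = x] (mod gcd b N)}"
  then have y_range: "y \<in> {0..<N}" and gcd_dvd: "gcd b N dvd y - x"
    by (simp_all add: cong_iff_dvd_diff)
  obtain k where "0 < k" and solution: "[int k * b = y - x] (mod N)"
    using gcd_dvd assms by (rule cong_solve_pos_nat)
  have "[y = x + int k * b] (mod N)"
    using cong_add[OF cong_refl[of x] cong_sym[OF solution]] by simp
  then have "(rotation N b ^^ k) x = y"
    using \<open>0 < k\<close> y_range by (intro funpow_rotation_eqI)
  then show "y \<in> orbit (rotation N b) x"
    using \<open>0 < k\<close> by (auto simp: orbit_altdef)
qed

lemma mod_notin_atLeastAtMost:
  fixes n y N :: int
  assumes "n < y" and "y \<le> N"
  shows "y mod N \<notin> {1..n}"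
proof (cases "0 \<le> y \<and> y \<noteq> N")
  case True
  then show ?thesis
    using assms by simp
next
  case False
  then show ?thesis
    using assms by auto
qed

lemma sdie_eq_first_return_rotation:
  fixes l1 l2 l3 x :: int
  assumes pos: "0 < l1" "0 < l2" "0 < l3" and x: "x \<in> {1..l1 + l2 + l3}"
  shows "sdie l1 l2 l3 x =
    first_return (rotation (l1 + 2 * l2 + l3) (l2 + l3)) {1..l1 + l2 + l3} x"
    (is "_ = first_return ?R ?I x")
proof -
  consider (left) "x \<le> l1" | (middle) "l1 < x" "x \<le> l1 + l2" | (right) "l1 + l2 < x"
    by linarith
  then show ?thesis
  proof cases
    case left
    have "(?R ^^ 1) x = x + l2 + l3"
      using left pos x by (intro funpow_rotation_eqI) (auto simp: algebra_simps)
    with left show ?thesis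
      using pos x first_return_eqI[of 1 ?R x ?I] by (simp add: sdie_def)
  next
    case middle
    have "(?R ^^ 2) x = x + l3 - l1"
      using middle pos
      by (intro funpow_rotation_eqI) (auto simp: cong_iff_lin algebra_simps intro!: exI[of _ 1])
    moreover have "(?R ^^ 1) x \<notin> ?I"
      using middle mod_notin_atLeastAtMost[of "l1 + l2 + l3" "x + (l2 + l3)" "l1 + 2 * l2 + l3"]
      by (simp add: rotation_def)
    ultimately show ?thesis
      using middle pos first_return_eqI[of 2 ?R x ?I] by (simp add: sdie_def less_2_cases_iff)
  next
    case right
    have "(?R ^^ 1) x = x - l1 - l2"
      using right pos x
      by (intro funpow_rotation_eqI) (auto simp: cong_iff_lin algebra_simps intro!: exI[of _ 1])
    with right show ?thesis
      using pos x first_return_eqI[of 1 ?R x ?I] by (simp add: sdie_def)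
  qed
qed

lemma orbit_sdie_eq_cong_class:
  fixes l1 l2 l3 x :: int
  assumes pos: "0 < l1" "0 < l2" "0 < l3" and x: "x \<in> {1..l1 + l2 + l3}"
  shows "orbit (sdie l1 l2 l3) x =
    {y \<in> {1..l1 + l2 + l3}. [y = x] (mod gcd (l1 + l2) (l2 + l3))}"
proof -
  let ?I = "{1..l1 + l2 + l3}" and ?N = "l1 + 2 * l2 + l3"
  let ?R = "rotation ?N (l2 + l3)"
  have I_subset: "?I \<subseteq> {0..<?N}"
    using pos by auto
  have orbit_R: "orbit ?R y = {z \<in> {0..<?N}. [z = y] (mod gcd (l2 + l3) ?N)}" for y
    using pos by (intro orbit_rotation) simp
  have "orbit (sdie l1 l2 l3) x = orbit (first_return ?R ?I) x"
  proof (rule orbit_cong0[OF x])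
    show "sdie l1 l2 l3 \<in> ?I \<rightarrow> ?I"
      using permutes_in_image[OF sdie_permutes[OF pos]] by blast
  qed (rule sdie_eq_first_return_rotation[OF pos])
  also have "\<dots> = orbit ?R x \<inter> ?I"
  proof (rule orbit_first_return[OF x])
    fix y assume y: "y \<in> ?I"
    then have "y \<in> orbit ?R y"
      using I_subset by (auto simp: orbit_R)
    with y show "orbit ?R y \<inter> ?I \<noteq> {}"
      by blast
  qed
  also have "\<dots> = {y \<in> ?I. [y = x] (mod gcd (l2 + l3) ?N)}"
    using I_subset by (auto simp: orbit_R)
  also have "gcd (l2 + l3) ?N = gcd (l1 + l2) (l2 + l3)"
    using gcd_add2[of "l2 + l3" "l1 + l2"] by (simp add: algebra_simps gcd.commute)
  finally show ?thesis .
qed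

lemma atLeastAtMost_cong_class_eq:
  fixes a b d x :: int
  assumes "0 < d"
  shows "{y \<in> {a..b}. [y = x] (mod d)} =
    {x + k * d | k :: int.
      real_of_int (a - x) / real_of_int d \<le> real_of_int k \<and>
      real_of_int k \<le> real_of_int (b - x) / real_of_int d}"
proof -
  have bounds: "real_of_int (a - x) / real_of_int d \<le> real_of_int k \<and>
      real_of_int k \<le> real_of_int (b - x) / real_of_int d \<longleftrightarrow> x + k * d \<in> {a..b}" for k
  proof -
    have "real_of_int (a - x) / real_of_int d \<le> real_of_int k \<longleftrightarrow> a - x \<le> k * d"
      using assms by (simp add: pos_divide_le_eq flip: of_int_mult of_int_diff)
    moreover have "real_of_int k \<le> real_of_int (b - x) / real_of_int d \<longleftrightarrow> k * d \<le> b - x"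
      using assms by (simp add: pos_le_divide_eq flip: of_int_mult of_int_diff)
    ultimately show ?thesis
      by auto
  qed
  have cong_iff: "[y = x] (mod d) \<longleftrightarrow> (\<exists>k. y = x + k * d)" for y
    unfolding cong_sym_eq[of y x] by (simp add: cong_iff_lin mult.commute)
  show ?thesis
    unfolding bounds cong_iff by auto
qed

theorem theorem14:
  fixes l1 l2 l3 n d x :: int
  assumes "0 < l1" and "0 < l2" and "0 < l3" and "l1 + l2 + l3 = n"
    and "d = gcd (l1 + l2) (l2 + l3)"
    and "x \<in> {1..n}"
  shows "orbit (sdie l1 l2 l3) x =
    {x + k * d | k :: int.
      real_of_int (1 - x) / real_of_int d \<le> real_of_int k \<and>
      real_of_int k \<le> real_of_int (n - x) / real_of_int d}"
proof -
  have "orbit (sdie l1 l2 l3) x = {y \<in> {1..n}. [y = x] (mod d)}"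
    using orbit_sdie_eq_cong_class[of l1 l2 l3 x] assms by simp
  moreover have "0 < d"
    using assms by (simp add: gcd_pos_int)
  ultimately show ?thesis
    by (simp only: atLeastAtMost_cong_class_eq)
qed

end
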